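(* Let $J=\{1,\dots,n\}$ be a set of jobs with true demands $(a_j,d_j,e_j)$, and let $C$ be non-decreasing and convex. Consider the attacker's problem $C_{maxmin}(a,d,e,\beta)$ in the total-energy model with $\beta=1$. Then there is an optimal attack in which, for every job $j\in J$, the forged demand satisfies $a'_j=d'_j=t_j$ for some $t_j\in[a_j,d_j]$. That is, there exist slots $t_j\in[a_j,d_j]$, $j\in J$, such that replacing each demand $(a_j,d_j,e_j)$ by the single forged demand $(t_j,t_j,e_j)$ gives a forged demand set attaining $C_{maxmin}(a,d,e,1)$.
   Context: Total-energy model. Time is slotted, with a finite horizon of slots $1,\dots,T$; for integers $k\le l$, $[k,l]$ denotes the set of slots $\{k,\dots,l\}$. There are $n\ge 1$ jobs $J=\{1,\dots,n\}$. Job $j$ has demand $(a_j,d_j,e_j)$ with $a_j,d_j\in\{1,\dots,T\}$, $a_j\le d_j$, $e_j>0$: it arrives at the beginning of slot $a_j$ and must receive total energy $e_j$ by the end of slot $d_j$ (preemption allowed). The cost function $C:[0,\infty)\to[0,\infty)$ is non-decreasing and convex, and does not depend on the slot. Operator's problem. Given a finite family of (possibly forged) demands $(a'_i,d'_i,e'_i)$, $i\in J'=\{1,\dots,m\}$, $$C_{min}(a',d',e')=\min_{\mathcal S}\sum_{t=1}^T C\Big(\sum_{i\in J'}\mathcal S_{it}\Big)$$ over $\mathcal S_{it}\ge 0$ with $\sum_{t=a'_i}^{d'_i}\mathcal S_{it}=e'_i$ for all $i\in J'$. Attacker's problem. The attacker replaces each job $j$ by a finite collection $b_j$ of (sub)jobs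 $(a'_k,d'_k,e'_k)$, $1\le k\le |b_j|$, with $a'_k,d'_k$ positive integers, $e'_k\ge 0$, $a_j\le a'_k\le d'_k\le d_j$, and $\sum_k e'_k=e_j$. The forged demand family is the union of all $b_j$. Let $J^*=\{j\in J: b_j\ne\{(a_j,d_j,e_j)\}\}$ be the set of modified jobs. For $\beta\in[0,1]$, $C_{maxmin}(a,d,e,\beta)$ is the maximum of $C_{min}(a',d',e')$ over all such forgeries with $|J^*|\le\beta n$; an attack is optimal if it attains this maximum. *)

theory Defs
  imports "HOL-Analysis.Analysis"
begin

text \<open>A demand is a triple of arrival slot, deadline slot and energy. A finite family of demands
  is a list, so that equal demands may occur several times; its members are indexed from 0.\<close>

type_synonym demand = "nat \<times> nat \<times> real"

definition feasible_schedule :: "nat \<Rightarrow> demand list \<Rightarrow> (nat \<Rightarrow> nat \<Rightarrow> real) \<Rightarrow> bool" where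
  "feasible_schedule T ds S \<longleftrightarrow>
     (\<forall>i<length ds. \<forall>t\<in>{1..T}. 0 \<le> S i t) \<and>
     (\<forall>i<length ds. case ds ! i of (a', d', e') \<Rightarrow> (\<Sum>t=a'..d'. S i t) = e')"

definition schedule_cost ::
  "nat \<Rightarrow> (real \<Rightarrow> real) \<Rightarrow> demand list \<Rightarrow> (nat \<Rightarrow> nat \<Rightarrow> real) \<Rightarrow> real" where
  "schedule_cost T C ds S = (\<Sum>t=1..T. C (\<Sum>i<length ds. S i t))"

text \<open>For demands with nonempty windows inside \<open>{1..T}\<close> and nonnegative energies, and for a
  nonnegative, non-decreasing, convex cost function on \<open>{0..}\<close> (hence continuous there, including
  at 0), this infimum ranges over a nonempty set bounded below by 0 and is a minimum.\<close>

definition C_min :: "nat \<Rightarrow> (real \<Rightarrow> real) \<Rightarrow> demand list \<Rightarrow> real" where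
  "C_min T C ds = (INF S\<in>{S. feasible_schedule T ds S}. schedule_cost T C ds S)"

definition is_split :: "demand \<Rightarrow> demand list \<Rightarrow> bool" where
  "is_split dem bs \<longleftrightarrow> (case dem of (a, d, e) \<Rightarrow>
     (\<forall>(a', d', e')\<in>set bs. 1 \<le> a' \<and> a \<le> a' \<and> a' \<le> d' \<and> d' \<le> d \<and> 0 \<le> e') \<and>
     (\<Sum>(a', d', e')\<leftarrow>bs. e') = e)"

text \<open>Below, job \<open>j\<close> in \<open>{1..n}\<close> has demand \<open>(a j, d j, e j)\<close> and is replaced by \<open>b j\<close>; values
  outside \<open>{1..n}\<close> are irrelevant.\<close>

definition forged_demands :: "nat \<Rightarrow> (nat \<Rightarrow> demand list) \<Rightarrow> demand list" where
  "forged_demands n b = concat (map b [1..<Suc n])"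

definition modified_jobs ::
  "nat \<Rightarrow> (nat \<Rightarrow> nat) \<Rightarrow> (nat \<Rightarrow> nat) \<Rightarrow> (nat \<Rightarrow> real) \<Rightarrow> (nat \<Rightarrow> demand list) \<Rightarrow> nat set" where
  "modified_jobs n a d e b = {j\<in>{1..n}. b j \<noteq> [(a j, d j, e j)]}"

definition is_attack ::
  "nat \<Rightarrow> (nat \<Rightarrow> nat) \<Rightarrow> (nat \<Rightarrow> nat) \<Rightarrow> (nat \<Rightarrow> real) \<Rightarrow> real \<Rightarrow> (nat \<Rightarrow> demand list) \<Rightarrow> bool" where
  "is_attack n a d e \<beta> b \<longleftrightarrow>
     (\<forall>j\<in>{1..n}. is_split (a j, d j, e j) (b j)) \<and>
     real (card (modified_jobs n a d e b)) \<le> \<beta> * real n"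

definition C_maxmin ::
  "nat \<Rightarrow> (real \<Rightarrow> real) \<Rightarrow> nat \<Rightarrow> (nat \<Rightarrow> nat) \<Rightarrow> (nat \<Rightarrow> nat) \<Rightarrow> (nat \<Rightarrow> real) \<Rightarrow> real \<Rightarrow> real" where
  "C_maxmin T C n a d e \<beta> = (SUP b\<in>{b. is_attack n a d e \<beta> b}. C_min T C (forged_demands n b))"

text \<open>Optimality is stated as a maximiser rather than as equality with the supremum
  \<open>C_maxmin\<close>, so that it does not rely on boundedness.\<close>

definition optimal_attack ::
  "nat \<Rightarrow> (real \<Rightarrow> real) \<Rightarrow> nat \<Rightarrow> (nat \<Rightarrow> nat) \<Rightarrow> (nat \<Rightarrow> nat) \<Rightarrow> (nat \<Rightarrow> real) \<Rightarrow> real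
    \<Rightarrow> (nat \<Rightarrow> demand list) \<Rightarrow> bool" where
  "optimal_attack T C n a d e \<beta> b \<longleftrightarrow>
     is_arg_max (\<lambda>b. C_min T C (forged_demands n b)) (is_attack n a d e \<beta>) b"

end

theory Submission
  imports Defs
begin

text \<open>Schedule every forged subjob of an attack entirely in its arrival slot. This bounds the
  operator's minimum by the cost of a load profile to which each job \<open>j\<close> contributes its
  energy \<open>e j\<close>, distributed over the slots of its window. That cost is convex in the distribution
  of each single job, so the jobs can one after the other be concentrated in a single slot without
  decreasing the cost. The result is the load of a single-slot attack, which leaves the operator
  no freedom, so no attack beats the best of the finitely many single-slot attacks.\<close>

text \<open>Costs are computed over positions in the forged list, whereas the convexity argument
  works job by job; this regrouping links the two.\<close>

lemma sum_concat_map_upt: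
  fixes f :: "'a \<Rightarrow> 'b::comm_monoid_add"
  shows "(\<Sum>i<length (concat (map b [1..<Suc n])). f (concat (map b [1..<Suc n]) ! i))
         = (\<Sum>j=1..n. \<Sum>x\<leftarrow>b j. f x)"
proof -
  have "(\<Sum>i<length xs. f (xs ! i)) = (\<Sum>x\<leftarrow>xs. f x)" for xs
    by (simp add: sum_list_sum_nth atLeast0LessThan)
  moreover have "(\<Sum>x\<leftarrow>concat (map b ks). f x) = (\<Sum>j\<leftarrow>ks. \<Sum>x\<leftarrow>b j. f x)" for ks
    by (induction ks) auto
  moreover have "(\<Sum>j\<leftarrow>[1..<Suc n]. g j) = (\<Sum>j=1..n. g j)" for g :: "nat \<Rightarrow> 'b"
    by (simp only: interv_sum_list_conv_sum_set_nat set_upt atLeastLessThanSuc_atLeastAtMost)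
  ultimately show ?thesis
    by simp
qed

text \<open>With weight \<open>w s / e\<close>, the load \<open>y s + w s\<close> is a convex
  combination of \<open>y s\<close> and \<open>y s + e\<close>, so the extra cost in slot
  \<open>s\<close> is at most that share of the increment \<open>D s\<close>. The shares add up to
  1, hence the total extra cost is at most the largest increment over \<open>W\<close>, which is the
  extra cost of putting all of \<open>e\<close> into a maximising slot.\<close>

lemma concentrate_load:
  fixes C :: "real \<Rightarrow> real"
  assumes conv: "convex_on {0..} C" and fin: "finite A" and W: "W \<subseteq> A"
    and y: "\<And>s. s \<in> A \<Longrightarrow> 0 \<le> y s" and w: "\<And>s. s \<in> A \<Longrightarrow> 0 \<le> w s"
    and supp: "\<And>s. s \<in> A - W \<Longrightarrow> w s = 0"
    and e: "(\<Sum>s\<in>A. w s) = e" "0 < e"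
  shows "\<exists>t\<in>W. (\<Sum>s\<in>A. C (y s + w s)) \<le> (\<Sum>s\<in>A. C (y s + (if t = s then e else 0)))"
proof -
  define D where "D s = C (y s + e) - C (y s)" for s
  have finW: "finite W" using fin W by (rule finite_subset[rotated])
  \<comment> \<open>Otherwise \<open>w\<close> would vanish on \<open>A\<close>, contradicting its
    positive sum \<open>e\<close>.\<close>
  have "W \<noteq> {}"
    using e supp by auto
  then have "Max (D ` W) \<in> D ` W" using finW by auto
  then obtain t where t: "t \<in> W" "D t = Max (D ` W)" by force
  then have Dt: "D s \<le> D t" if "s \<in> W" for s
    using that finW by simp
  have tA: "t \<in> A" using t W by blast
  have step: "C (y s + w s) \<le> C (y s) + w s / e * D t" if s: "s \<in> A" for s
  proof -
    have "w s \<le> e"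
      using member_le_sum[of s A w] s w fin e by auto
    then have "C ((1 - w s / e) *\<^sub>R y s + (w s / e) *\<^sub>R (y s + e))
               \<le> (1 - w s / e) * C (y s) + (w s / e) * C (y s + e)"
      using convex_onD[OF conv, of "w s / e" "y s" "y s + e"] w[OF s] y[OF s] e(2) by simp
    moreover have "(1 - w s / e) *\<^sub>R y s + (w s / e) *\<^sub>R (y s + e) = y s + w s"
      using e(2) by (simp add: field_simps)
    ultimately have "C (y s + w s) \<le> C (y s) + w s / e * D s"
      by (simp add: D_def algebra_simps)
    \<comment> \<open>Maximality of \<open>D t\<close> is known only on \<open>W\<close>; outside
      \<open>W\<close> the weight is 0.\<close>
    also have "w s / e * D s \<le> w s / e * D t"
      using Dt[of s] supp[of s] w[OF s] e(2) s
      by (cases "s \<in> W") (auto intro: mult_left_mono divide_right_mono)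
    finally show ?thesis by simp
  qed
  have "(\<Sum>s\<in>A. C (y s + w s)) \<le> (\<Sum>s\<in>A. C (y s) + w s / e * D t)"
    by (intro sum_mono step)
  also have "\<dots> = (\<Sum>s\<in>A. C (y s)) + D t"
    using e by (simp add: sum.distrib flip: sum_distrib_right sum_divide_distrib)
  also have "\<dots> = (\<Sum>s\<in>A. C (y s) + (if t = s then D t else 0))"
    using tA fin by (simp add: sum.distrib)
  also have "\<dots> = (\<Sum>s\<in>A. C (y s + (if t = s then e else 0)))"
    by (intro sum.cong) (auto simp: D_def)
  finally show ?thesis using t(1) by blast
qed

text \<open>Induction over the jobs. The background load \<open>y\<close> is generalised so that it
  can absorb the jobs already concentrated.\<close>

lemma concentrate_loads:
  fixes C :: "real \<Rightarrow> real"
  assumes conv: "convex_on {0..} C" and fin: "finite A" and J: "finite J"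
    and W: "\<And>j. j \<in> J \<Longrightarrow> W j \<subseteq> A"
    and w: "\<And>j s. j \<in> J \<Longrightarrow> s \<in> A \<Longrightarrow> 0 \<le> w j s"
    and supp: "\<And>j s. j \<in> J \<Longrightarrow> s \<in> A - W j \<Longrightarrow> w j s = 0"
    and e: "\<And>j. j \<in> J \<Longrightarrow> (\<Sum>s\<in>A. w j s) = e j \<and> 0 < e j"
    and y: "\<And>s. s \<in> A \<Longrightarrow> 0 \<le> y s"
  shows "\<exists>t. (\<forall>j\<in>J. t j \<in> W j) \<and>
           (\<Sum>s\<in>A. C (y s + (\<Sum>j\<in>J. w j s)))
           \<le> (\<Sum>s\<in>A. C (y s + (\<Sum>j\<in>J. if t j = s then e j else 0)))"
  using J W w supp e y
proof (induction J arbitrary: y rule: finite_induct)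
  case empty
  then show ?case by simp
next
  case (insert x F)
  \<comment> \<open>Only job \<open>x\<close> moves here; the jobs of \<open>F\<close>, still spread
    out, count as background.\<close>
  have "\<exists>u\<in>W x. (\<Sum>s\<in>A. C ((y s + (\<Sum>j\<in>F. w j s)) + w x s))
      \<le> (\<Sum>s\<in>A. C ((y s + (\<Sum>j\<in>F. w j s)) + (if u = s then e x else 0)))"
    using insert.prems by (intro concentrate_load[OF conv fin]) (auto intro!: add_nonneg_nonneg sum_nonneg)
  then obtain u where u: "u \<in> W x"
    "(\<Sum>s\<in>A. C ((y s + (\<Sum>j\<in>F. w j s)) + w x s))
      \<le> (\<Sum>s\<in>A. C ((y s + (\<Sum>j\<in>F. w j s)) + (if u = s then e x else 0)))" ..
  \<comment> \<open>The concentrated job \<open>x\<close> joins the background under which the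
    induction hypothesis treats \<open>F\<close>.\<close>
  define y' where "y' s = y s + (if u = s then e x else 0)" for s
  have y': "0 \<le> y' s" if "s \<in> A" for s
    using insert.prems(4)[of x] insert.prems(5)[OF that] by (auto simp: y'_def)
  obtain t where t: "\<forall>j\<in>F. t j \<in> W j"
    "(\<Sum>s\<in>A. C (y' s + (\<Sum>j\<in>F. w j s))) \<le> (\<Sum>s\<in>A. C (y' s + (\<Sum>j\<in>F. if t j = s then e j else 0)))"
    using insert.IH[of y'] insert.prems y' by auto
  have cong: "(\<Sum>j\<in>F. if (t(x := u)) j = s then e j else 0) = (\<Sum>j\<in>F. if t j = s then e j else 0)" for s
    using insert.hyps by (intro sum.cong) auto
  show ?case
  proof (intro exI[of _ "t(x := u)"] conjI)
    show "\<forall>j\<in>insert x F. (t(x := u)) j \<in> W j"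
      using t(1) u(1) by auto
    show "(\<Sum>s\<in>A. C (y s + (\<Sum>j\<in>insert x F. w j s)))
        \<le> (\<Sum>s\<in>A. C (y s + (\<Sum>j\<in>insert x F. if (t(x := u)) j = s then e j else 0)))"
      unfolding sum.insert[OF insert.hyps] cong
      using u(2) t(2) by (simp add: y'_def add_ac)
  qed
qed

definition arrival_schedule :: "demand list \<Rightarrow> nat \<Rightarrow> nat \<Rightarrow> real" where
  "arrival_schedule ds i s = (if fst (ds ! i) = s then snd (snd (ds ! i)) else 0)"

lemma feasible_arrival_schedule:
  assumes "\<And>a' d' e'. (a', d', e') \<in> set ds \<Longrightarrow> a' \<le> d' \<and> 0 \<le> e'"
  shows "feasible_schedule T ds (arrival_schedule ds)"
  unfolding feasible_schedule_def
proof (intro conjI allI impI ballI)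
  fix i assume "i < length ds"
  moreover obtain a' d' e' where i: "ds ! i = (a', d', e')" by (cases "ds ! i")
  ultimately have window: "a' \<le> d' \<and> 0 \<le> e'" using assms by (metis nth_mem)
  then show "0 \<le> arrival_schedule ds i t" for t
    using i by (auto simp: arrival_schedule_def)
  show "case ds ! i of (a', d', e') \<Rightarrow> (\<Sum>t = a'..d'. arrival_schedule ds i t) = e'"
    using window i by (auto simp: arrival_schedule_def)
qed

lemma C_min_le_schedule_cost:
  assumes "\<And>x. 0 \<le> x \<Longrightarrow> 0 \<le> C x" and "feasible_schedule T ds S"
  shows "C_min T C ds \<le> schedule_cost T C ds S"
  unfolding C_min_def
proof (rule cINF_lower)
  show "bdd_below (schedule_cost T C ds ` {S. feasible_schedule T ds S})"
    by (intro bdd_belowI2[of _ 0])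
      (auto simp: schedule_cost_def feasible_schedule_def intro!: sum_nonneg assms(1))
qed (use assms in simp)

text \<open>A one-slot window fixes the energy in that slot. Feasibility still permits energy
  elsewhere, but never a negative amount, so every feasible load dominates the single-slot load and
  monotonicity of \<open>C\<close> compares the costs.\<close>

lemma C_min_single_slot_ge:
  fixes e :: "nat \<Rightarrow> real"
  assumes mono: "mono_on {0..} C"
    and t: "\<And>j. j \<in> {1..n} \<Longrightarrow> t j \<in> {1..T} \<and> 0 \<le> e j"
  shows "(\<Sum>s=1..T. C (\<Sum>j=1..n. if t j = s then e j else 0))
         \<le> C_min T C (forged_demands n (\<lambda>j. [(t j, t j, e j)]))"
proof -
  let ?ds = "forged_demands n (\<lambda>j. [(t j, t j, e j)])"
  have mem: "\<exists>j\<in>{1..n}. x = (t j, t j, e j)" if "x \<in> set ?ds" for x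
    using that by (auto simp: forged_demands_def)
  have load: "(\<Sum>i<length ?ds. arrival_schedule ?ds i s) = (\<Sum>j=1..n. if t j = s then e j else 0)" for s
    unfolding forged_demands_def arrival_schedule_def
    using sum_concat_map_upt[of "\<lambda>x. if fst x = s then snd (snd x) else 0" "\<lambda>j. [(t j, t j, e j)]" n]
    by (simp del: upt_Suc cong: if_cong)
  show ?thesis unfolding C_min_def
  proof (rule cINF_greatest)
    show "{S. feasible_schedule T ?ds S} \<noteq> {}"
    proof -
      have "feasible_schedule T ?ds (arrival_schedule ?ds)"
        by (rule feasible_arrival_schedule) (use mem t in force)
      then show ?thesis by blast
    qed
  next
    fix S assume "S \<in> {S. feasible_schedule T ?ds S}"
    then have feas: "feasible_schedule T ?ds S" by simp
    then have S: "0 \<le> S i s" if "i < length ?ds" "s \<in> {1..T}" for i s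
      using that by (auto simp: feasible_schedule_def)
    from feas have Se: "case ?ds ! i of (a', d', e') \<Rightarrow> (\<Sum>t=a'..d'. S i t) = e'" if "i < length ?ds" for i
      using that by (auto simp: feasible_schedule_def)
    \<comment> \<open>Equality in the slot of the demand, by the energy constraint; elsewhere the
      left side is 0.\<close>
    have le: "arrival_schedule ?ds i s \<le> S i s" if i: "i < length ?ds" and s: "s \<in> {1..T}" for i s
    proof -
      obtain j where "?ds ! i = (t j, t j, e j)" using mem nth_mem[OF i] by blast
      then show ?thesis using Se[OF i] S[OF i s] by (auto simp: arrival_schedule_def)
    qed
    show "(\<Sum>s=1..T. C (\<Sum>j=1..n. if t j = s then e j else 0)) \<le> schedule_cost T C ?ds S"
      unfolding schedule_cost_def
    proof (rule sum_mono)
      fix s assume s: "s \<in> {1..T}"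
      have "(\<Sum>j=1..n. if t j = s then e j else 0) \<le> (\<Sum>i<length ?ds. S i s)"
        unfolding load[symmetric] using le s by (intro sum_mono) auto
      moreover have "0 \<le> (\<Sum>j=1..n. if t j = s then e j else 0)"
        using t by (intro sum_nonneg) auto
      ultimately show "C (\<Sum>j=1..n. if t j = s then e j else 0) \<le> C (\<Sum>i<length ?ds. S i s)"
        by (intro mono_onD[OF mono]) auto
    qed
  qed
qed

lemma single_slot_attack_dominates:
  fixes e :: "nat \<Rightarrow> real"
  assumes jobs: "\<And>j. j \<in> {1..n} \<Longrightarrow> a j \<in> {1..T} \<and> d j \<in> {1..T} \<and> a j \<le> d j \<and> 0 < e j"
    and nonneg: "\<And>x. 0 \<le> x \<Longrightarrow> 0 \<le> C x"
    and mono: "mono_on {0..} C" and conv: "convex_on {0..} C"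
    and split: "\<And>j. j \<in> {1..n} \<Longrightarrow> is_split (a j, d j, e j) (b j)"
  shows "\<exists>t. (\<forall>j\<in>{1..n}. t j \<in> {a j..d j}) \<and>
           C_min T C (forged_demands n b)
           \<le> C_min T C (forged_demands n (\<lambda>j. [(t j, t j, e j)]))"
proof -
  let ?ds = "forged_demands n b"
  \<comment> \<open>The energy that job \<open>j\<close> puts into slot \<open>s\<close> when each
    of its subjobs runs in its arrival slot.\<close>
  define w where "w j s = (\<Sum>x\<leftarrow>b j. if fst x = s then snd (snd x) else 0)" for j s
  have sub: "a j \<le> a' \<and> a' \<le> d' \<and> d' \<le> d j \<and> 0 \<le> e'"
    if "j \<in> {1..n}" "(a', d', e') \<in> set (b j)" for j a' d' e'
    using split[OF that(1)] that(2) by (auto simp: is_split_def)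
  \<comment> \<open>Each subjob arrives in exactly one slot of \<open>{1..T}\<close>, so its energy
    is counted once.\<close>
  have total: "(\<Sum>s=1..T. w j s) = e j" if j: "j \<in> {1..n}" for j
  proof -
    have slot: "fst x \<in> {1..T}" if "x \<in> set (b j)" for x
      using sub[OF j, of "fst x" "fst (snd x)" "snd (snd x)"] jobs[OF j] that by auto
    have "(\<Sum>s=1..T. \<Sum>x\<leftarrow>xs. if fst x = s then snd (snd x) else 0) = (\<Sum>x\<leftarrow>xs. snd (snd x))"
      if "set xs \<subseteq> set (b j)" for xs
      using that
    proof (induction xs)
      case (Cons x xs)
      then show ?case using slot[of x] by (simp add: sum.distrib)
    qed simp
    moreover have "(\<Sum>x\<leftarrow>b j. snd (snd x)) = e j"
      using split[OF j] by (simp add: is_split_def case_prod_unfold)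
    ultimately show ?thesis by (simp add: w_def)
  qed
  have w0: "0 \<le> w j s" if "j \<in> {1..n}" for j s
    using sub[OF that] unfolding w_def by (intro sum_list_nonneg) auto
  have supp: "w j s = 0" if "j \<in> {1..n}" "s \<notin> {a j..d j}" for j s
  proof -
    have "map (\<lambda>x. if fst x = s then snd (snd x) else 0) (b j) = map (\<lambda>_. 0::real) (b j)"
      using sub[OF that(1)] that(2) by fastforce
    then show ?thesis unfolding w_def by (simp only: sum_list_0)
  qed
  \<comment> \<open>The summand 0 is the empty initial background load.\<close>
  have "\<exists>t. (\<forall>j\<in>{1..n}. t j \<in> {a j..d j}) \<and>
      (\<Sum>s=1..T. C (0 + (\<Sum>j=1..n. w j s)))
      \<le> (\<Sum>s=1..T. C (0 + (\<Sum>j=1..n. if t j = s then e j else 0)))"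
    using jobs total w0 supp by (intro concentrate_loads[OF conv]) fastforce+
  then obtain t where t: "\<forall>j\<in>{1..n}. t j \<in> {a j..d j}"
      "(\<Sum>s=1..T. C (\<Sum>j=1..n. w j s)) \<le> (\<Sum>s=1..T. C (\<Sum>j=1..n. if t j = s then e j else 0))"
    by auto
  have "feasible_schedule T ?ds (arrival_schedule ?ds)"
  proof (rule feasible_arrival_schedule)
    fix a' d' e' assume "(a', d', e') \<in> set ?ds"
    then obtain j where "j \<in> {1..n}" "(a', d', e') \<in> set (b j)"
      by (fastforce simp: forged_demands_def less_Suc_eq_le simp del: upt_Suc)
    from sub[OF this] show "a' \<le> d' \<and> 0 \<le> e'" by simp
  qed
  then have "C_min T C ?ds \<le> schedule_cost T C ?ds (arrival_schedule ?ds)"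
    by (intro C_min_le_schedule_cost nonneg)
  also have "\<dots> = (\<Sum>s=1..T. C (\<Sum>j=1..n. w j s))"
    unfolding schedule_cost_def forged_demands_def arrival_schedule_def w_def
    by (simp only: sum_concat_map_upt[of "\<lambda>x. if fst x = s then snd (snd x) else 0" b n for s])
  also note t(2)
  also have "(\<Sum>s=1..T. C (\<Sum>j=1..n. if t j = s then e j else 0))
      \<le> C_min T C (forged_demands n (\<lambda>j. [(t j, t j, e j)]))"
  proof (rule C_min_single_slot_ge[OF mono])
    fix j assume j: "j \<in> {1..n}"
    show "t j \<in> {1..T} \<and> 0 \<le> e j"
      using bspec[OF t(1) j] jobs[OF j] by auto
  qed
  finally show ?thesis using t(1) by blast
qed

theorem lemma1:
  fixes T n :: nat
    and C :: "real \<Rightarrow> real"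
    and a d :: "nat \<Rightarrow> nat"
    and e :: "nat \<Rightarrow> real"
  assumes "1 \<le> n"
    and "\<And>j. j \<in> {1..n} \<Longrightarrow> a j \<in> {1..T} \<and> d j \<in> {1..T} \<and> a j \<le> d j \<and> 0 < e j"
    and "\<And>x. 0 \<le> x \<Longrightarrow> 0 \<le> C x"
    and "mono_on {0..} C"
    and "convex_on {0..} C"
  shows "\<exists>t. (\<forall>j\<in>{1..n}. t j \<in> {a j..d j}) \<and>
           optimal_attack T C n a d e 1 (\<lambda>j. [(t j, t j, e j)]) \<and>
           C_min T C (forged_demands n (\<lambda>j. [(t j, t j, e j)])) = C_maxmin T C n a d e 1"
proof -
  define V where "V t = C_min T C (forged_demands n (\<lambda>j. [(t j, t j, e j)]))" for t
  \<comment> \<open>Extensional functions fix the values outside \<open>{1..n}\<close>, which makes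
    the set of slot choices finite.\<close>
  define P where "P = (\<Pi>\<^sub>E j\<in>{1..n}. {a j..d j})"
  have finP: "finite P" unfolding P_def by (intro finite_PiE) auto
  have "restrict a {1..n} \<in> P"
    using assms(2) by (auto simp: P_def)
  then have "Max (V ` P) \<in> V ` P" using finP by (intro Max_in) auto
  then obtain t where t: "t \<in> P" "V t = Max (V ` P)" by force
  then have tmax: "V u \<le> V t" if "u \<in> P" for u
    using that finP by simp
  have slots: "\<forall>j\<in>{1..n}. t j \<in> {a j..d j}"
    using t(1) unfolding P_def by blast
  have best: "C_min T C (forged_demands n b) \<le> V t" if b: "is_attack n a d e 1 b" for b
  proof -
    have "is_split (a j, d j, e j) (b j)" if "j \<in> {1..n}" for j
      using b that by (simp add: is_attack_def)
    from single_slot_attack_dominates[where a = a and d = d and e = e and b = b and C = C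
        and T = T and n = n, OF assms(2-5) this]
    obtain u where u: "\<forall>j\<in>{1..n}. u j \<in> {a j..d j}" "C_min T C (forged_demands n b) \<le> V u"
      unfolding V_def by blast
    \<comment> \<open>The choice \<open>u\<close> is arbitrary outside \<open>{1..n}\<close>, but
      the forged list reads only indices in that range.\<close>
    have "V u = V (restrict u {1..n})"
      unfolding V_def forged_demands_def
      by (intro arg_cong[where f = "C_min T C"] arg_cong[where f = concat] map_cong) auto
    moreover have "restrict u {1..n} \<in> P"
      using u(1) by (auto simp: P_def)
    ultimately show ?thesis using u(2) tmax[of "restrict u {1..n}"] by simp
  qed
  \<comment> \<open>For \<beta> = 1 the budget is \<open>n\<close>, so any set of modified jobs
    fits.\<close>
  have "card (modified_jobs n a d e b) \<le> card {1..n}" for b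
    unfolding modified_jobs_def by (intro card_mono) auto
  then have attack: "is_attack n a d e 1 (\<lambda>j. [(t j, t j, e j)])"
    using slots assms(2) by (fastforce simp: is_attack_def is_split_def)
  have "optimal_attack T C n a d e 1 (\<lambda>j. [(t j, t j, e j)])"
    unfolding optimal_attack_def is_arg_max_linorder using attack best by (simp add: V_def)
  \<comment> \<open>The value \<open>V t\<close> is attained by an attack and bounds all others, so
    it is the supremum.\<close>
  moreover have "V t = C_maxmin T C n a d e 1"
    unfolding C_maxmin_def
    by (rule cSup_eq_maximum[symmetric]) (use attack best in \<open>auto simp: V_def\<close>)
  ultimately show ?thesis using slots by (auto simp: V_def)
qed

end
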